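(* Let $0<\lambda\le1$ and let $f(z)=z+\sum_{n\ge2}a_nz^n\in\mathcal{ST}_{ss}(\lambda)$. Then $$|a_2|\le\lambda,\qquad |a_3|\le\frac{\lambda}{2}.$$ The first inequality is sharp for the function $f(z)=\overline{\mu}F_{\lambda}(\mu z)$ and the second for $f(z)=\overline{\mu}F_{\lambda,2}(\mu z)$, where $\mu$ is a unimodular complex number.
   Context: $\mathbb{D}=\{z\in\mathbb{C}:|z|<1\}$. $\mathcal{A}$ is the class of holomorphic functions in $\mathbb{D}$ of the form $f(z)=z+\sum_{n\ge 2}a_nz^n$. $\mathcal{ST}$ is the class of univalent $f\in\mathcal{A}$ with $\Re\{zf'(z)/f(z)\}>0$ in $\mathbb{D}$. For $0<\lambda\le1$, $\mathcal{ST}_{ss}(\lambda)$ is the subfamily of $f\in\mathcal{ST}$ satisfying $zf'(z)/f(z)\prec(1+z)^\lambda$ in $\mathbb{D}$, where $p\prec q$ (subordination) means $p=q\circ\omega$ for some analytic $\omega:\mathbb{D}\to\mathbb{D}$ with $\omega(0)=0$. For $n\ge1$, $F_{\lambda,n}(z)=z\exp\left(\int_0^z\frac{(1+t^n)^\lambda-1}{t}\,\mathrm{d}t\right)$, and $F_\lambda=F_{\lambda,1}$. All powers use the branch equal to $1$ at the origin. "Sharp for" a function means that equality holds for that function. *)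

theory Defs
  imports "HOL-Complex_Analysis.Complex_Analysis"
begin

abbreviation unit_disc :: "complex set" where
  "unit_disc \<equiv> ball 0 1"

definition taylor_coeff :: "(complex \<Rightarrow> complex) \<Rightarrow> nat \<Rightarrow> complex" where
  "taylor_coeff f n = fps_nth (fps_expansion f 0) n"

text \<open>Functions are total, but only their values on the unit disc matter here and below.\<close>

definition class_A :: "(complex \<Rightarrow> complex) set" where
  "class_A = {f. f holomorphic_on unit_disc \<and> taylor_coeff f 0 = 0 \<and> taylor_coeff f 1 = 1}"

text \<open>
  The function \<open>z f'(z) / f(z)\<close>. For normalised univalent \<open>f\<close> it has a removable singularity
  at the origin, where its value is \<open>1\<close>; the literal quotient would be \<open>0 / 0 = 0\<close> there.
\<close>

definition zf'_over_f :: "(complex \<Rightarrow> complex) \<Rightarrow> complex \<Rightarrow> complex" where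
  "zf'_over_f f z = (if z = 0 then 1 else z * deriv f z / f z)"

definition ST :: "(complex \<Rightarrow> complex) set" where
  "ST = {f \<in> class_A. inj_on f unit_disc \<and> (\<forall>z\<in>unit_disc. Re (zf'_over_f f z) > 0)}"

definition subordinate :: "(complex \<Rightarrow> complex) \<Rightarrow> (complex \<Rightarrow> complex) \<Rightarrow> bool"
    (infix "\<prec>\<^sub>s" 50) where
  "p \<prec>\<^sub>s q \<longleftrightarrow> (\<exists>\<omega>. \<omega> holomorphic_on unit_disc \<and> \<omega> ` unit_disc \<subseteq> unit_disc \<and> \<omega> 0 = 0 \<and>
     (\<forall>z\<in>unit_disc. p z = q (\<omega> z)))"

text \<open>
  For \<open>z\<close> in the unit disc, \<open>1 + z\<close> and \<open>1 + z ^ n\<close> (\<open>n \<ge> 1\<close>) lie in the right half-plane, where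
  the principal power \<open>powr\<close> is the branch equal to \<open>1\<close> at the origin.
\<close>

definition ST_ss :: "real \<Rightarrow> (complex \<Rightarrow> complex) set" where
  "ST_ss l = {f \<in> ST. zf'_over_f f \<prec>\<^sub>s (\<lambda>z. (1 + z) powr complex_of_real l)}"

text \<open>
  The integrand extends holomorphically to the unit disc (its value at the single point \<open>t = 0\<close>
  does not affect the integral), so the path from \<open>0\<close> to \<open>z\<close> is immaterial; the segment is used.
\<close>

definition F :: "real \<Rightarrow> nat \<Rightarrow> complex \<Rightarrow> complex" where
  "F l n z = z * exp (contour_integral (linepath 0 z)
                       (\<lambda>t. ((1 + t ^ n) powr complex_of_real l - 1) / t))"

end

theory Submission
  imports Defs
begin

text \<open>
  Write \<open>\<lambda>\<close> for the exponent \<open>l\<close>, and \<open>z f'(z) / f(z) = (1 + \<omega>(z))\<^sup>\<lambda>\<close> with a Schwarz function \<open>\<omega>(z) = c\<^sub>1 z + c\<^sub>2 z\<^sup>2 + \<dots>\<close>.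
  Comparing coefficients in \<open>z f' = f \<cdot> (1 + \<omega>)\<^sup>\<lambda>\<close> gives
  \<open>a\<^sub>2 = \<lambda> c\<^sub>1\<close> and \<open>a\<^sub>3 = (\<lambda> / 2) (c\<^sub>2 + ((3 \<lambda> - 1) / 2) c\<^sub>1\<^sup>2)\<close>
  (lemma \<open>coeffs_of_Schwarz_function\<close>). Since \<open>\<bar>(3 \<lambda> - 1) / 2\<bar> \<le> 1\<close> for
  \<open>0 < \<lambda> \<le> 1\<close>, both bounds follow from \<open>\<bar>c\<^sub>2\<bar> \<le> 1 - \<bar>c\<^sub>1\<bar>\<^sup>2\<close>, which is the
  Schwarz-Pick inequality at the origin for \<open>\<omega>(z) / z\<close>
  (lemma \<open>Schwarz_function_second_coeff\<close>).

  The rotated functions \<open>F\<close> have \<open>z f'(z) / f(z) = (1 + (\<mu> z)\<^sup>n)\<^sup>\<lambda>\<close>, so they correspond to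
  \<open>\<omega>(z) = (\<mu> z)\<^sup>n\<close>: for \<open>n = 1\<close> one has \<open>\<bar>c\<^sub>1\<bar> = 1\<close>, for \<open>n = 2\<close> one has
  \<open>c\<^sub>1 = 0\<close> and \<open>\<bar>c\<^sub>2\<bar> = 1\<close>, and the same coefficient formulas give equality. What takes work
  is that these functions belong to the class, in particular that they are univalent. This is
  the theorem that starlike functions are univalent; it is obtained here from the
  Noshiro-Warschawski criterion in the logarithmic coordinate (lemma \<open>starlike_imp_univalent\<close>).
\<close>

section \<open>Power series at the centre of the disc\<close>

lemma has_fps_expansion_taylor:
  assumes "f holomorphic_on unit_disc"
  shows "f has_fps_expansion fps_expansion f 0"
  using assms by (intro has_fps_expansion_fps_expansion[of unit_disc]) auto

lemma taylor_coeff_eqI: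
  assumes "f has_fps_expansion A"
  shows "taylor_coeff f n = fps_nth A n"
  using fps_expansion_eqI[OF assms] by (simp add: taylor_coeff_def)

lemma has_fps_expansion_transfer_disc:
  assumes "f has_fps_expansion A" and "\<And>z. z \<in> unit_disc \<Longrightarrow> f z = g z"
  shows "g has_fps_expansion A"
proof -
  have "\<forall>\<^sub>F z in nhds (0::complex). z \<in> unit_disc"
    by (rule eventually_nhds_in_open) auto
  then have "\<forall>\<^sub>F z in nhds 0. f z = g z"
    by (rule eventually_mono) (rule assms(2))
  then show ?thesis
    using has_fps_expansion_cong[OF _ refl] assms(1) by blast
qed

section \<open>The second coefficient of a Schwarz function\<close>

text \<open>
  The Moebius map taking \<open>g 0\<close> to \<open>0\<close> has derivative \<open>1 / (1 - \<bar>g 0\<bar>\<^sup>2)\<close> at \<open>g 0\<close>, so the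
  claim is the derivative bound of the Schwarz lemma for its composition with \<open>g\<close>.
\<close>

lemma Schwarz_Pick_at_0:
  assumes holg: "g holomorphic_on unit_disc" and bound: "\<And>z. cmod z < 1 \<Longrightarrow> cmod (g z) < 1"
  shows "cmod (deriv g 0) \<le> 1 - (cmod (g 0))\<^sup>2"
proof -
  define a where "a = g 0"
  define \<phi> where "\<phi> = (\<lambda>z. Moebius_function 0 a (g z))"
  have a: "cmod a < 1"
    using bound[of 0] by (simp add: a_def)
  have "Moebius_function 0 a \<circ> g holomorphic_on unit_disc"
    by (intro holomorphic_on_compose_gen[OF holg Moebius_function_holomorphic[OF a]])
       (use bound in auto)
  then have hol: "\<phi> holomorphic_on unit_disc"
    by (simp add: \<phi>_def o_def)
  have le1: "cmod (deriv \<phi> 0) \<le> 1"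
  proof (rule Schwarz_Lemma(2)[OF hol])
    show "\<phi> 0 = 0" by (simp add: \<phi>_def a_def Moebius_function_eq_zero)
    show "cmod (\<phi> z) < 1" if "cmod z < 1" for z
      unfolding \<phi>_def using Moebius_function_norm_lt_1[OF a bound[OF that]] .
  qed (rule norm_zero[THEN ord_eq_less_trans, OF zero_less_one])
  have sq: "cnj a * a = of_real ((cmod a)\<^sup>2)"
    using complex_norm_square[of a] by (simp add: mult.commute)
  have pos: "0 < 1 - (cmod a)\<^sup>2"
    using a by (simp add: abs_square_less_1)
  have nz: "1 - cnj a * a \<noteq> 0"
    unfolding sq using pos by (metis eq_iff_diff_eq_0 less_irrefl of_real_1 of_real_eq_iff)
  have dg: "(g has_field_derivative deriv g 0) (at 0)"
    by (rule holomorphic_derivI[OF holg]) auto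
  have num: "((\<lambda>z. g z - a) has_field_derivative deriv g 0) (at 0)"
    using DERIV_diff[OF dg DERIV_const] by simp
  have den: "((\<lambda>z. 1 - cnj a * g z) has_field_derivative - (cnj a * deriv g 0)) (at 0)"
    using DERIV_diff[OF DERIV_const DERIV_cmult[OF dg]] by simp
  have "1 - cnj a * g 0 \<noteq> 0"
    using nz by (simp add: a_def)
  from DERIV_divide[OF num den this]
  have "(\<phi> has_field_derivative deriv g 0 / (1 - cnj a * a)) (at 0)"
    using nz unfolding \<phi>_def Moebius_function_simple by (simp add: a_def)
  then have "deriv \<phi> 0 = deriv g 0 / (1 - cnj a * a)"
    by (rule DERIV_imp_deriv)
  also have "1 - cnj a * a = of_real (1 - (cmod a)\<^sup>2)"
    by (simp add: sq)
  finally have "cmod (deriv \<phi> 0) = cmod (deriv g 0) / (1 - (cmod a)\<^sup>2)"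
    using pos by (simp add: norm_divide del: of_real_diff)
  with le1 pos show ?thesis
    by (simp add: a_def)
qed

text \<open>
  The quotient \<open>h(z) = \<omega>(z) / z\<close> has \<open>h(0) = c\<^sub>1\<close> and \<open>h'(0) = c\<^sub>2\<close>, and by the Schwarz
  lemma its values lie in the closed disc. If they stay in the open disc, Schwarz-Pick applies to
  \<open>h\<close>; otherwise the equality case of the Schwarz lemma makes \<open>\<omega>\<close> a rotation, where \<open>c\<^sub>2 = 0\<close>.
\<close>

lemma Schwarz_function_second_coeff:
  assumes hol\<omega>: "\<omega> holomorphic_on unit_disc" and im: "\<omega> ` unit_disc \<subseteq> unit_disc" and \<omega>0: "\<omega> 0 = 0"
  shows "cmod (taylor_coeff \<omega> 2) \<le> 1 - (cmod (taylor_coeff \<omega> 1))\<^sup>2"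
proof -
  have no: "cmod (\<omega> z) < 1" if "cmod z < 1" for z
    using im that by (auto simp: image_subset_iff)
  obtain h where holh: "h holomorphic_on unit_disc"
    and h: "\<And>z. cmod z < 1 \<Longrightarrow> \<omega> z = z * h z" and h0: "deriv \<omega> 0 = h 0"
    using Schwarz3[OF hol\<omega>] \<omega>0 by auto
  have "(\<lambda>z. z * h z) has_fps_expansion fps_X * fps_expansion h 0"
    by (intro has_fps_expansion_mult has_fps_expansion_fps_X has_fps_expansion_taylor holh)
  then have W: "\<omega> has_fps_expansion fps_X * fps_expansion h 0"
    by (rule has_fps_expansion_transfer_disc) (simp add: h)
  have c1: "taylor_coeff \<omega> 1 = h 0" and c2: "taylor_coeff \<omega> 2 = deriv h 0"
    unfolding taylor_coeff_eqI[OF W] by (auto simp: fps_expansion_def)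
  show ?thesis
  proof (cases "\<forall>z. cmod z < 1 \<longrightarrow> cmod (h z) < 1")
    case True
    then show ?thesis
      unfolding c1 c2 by (intro Schwarz_Pick_at_0 holh) auto
  next
    case False
    then obtain z where z: "cmod z < 1" "1 \<le> cmod (h z)"
      by (auto simp: not_less)
    have "(\<exists>z. cmod z < 1 \<and> z \<noteq> 0 \<and> cmod (\<omega> z) = cmod z) \<or> cmod (deriv \<omega> 0) = 1"
    proof (cases "z = 0")
      case True
      with z h0 Schwarz_Lemma(2)[OF hol\<omega> \<omega>0 no, of 0] show ?thesis by auto
    next
      case False
      have "cmod (\<omega> z) \<le> cmod z"
        by (rule Schwarz_Lemma(1)[OF hol\<omega> \<omega>0 no z(1)])
      moreover have "cmod z \<le> cmod (\<omega> z)"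
        using z h[OF z(1)] by (simp add: norm_mult mult_le_cancel_left1)
      ultimately show ?thesis using False z by force
    qed
    then obtain \<alpha> where \<alpha>: "\<And>z. cmod z < 1 \<Longrightarrow> \<omega> z = \<alpha> * z" "cmod \<alpha> = 1"
      using Schwarz_Lemma(3)[OF hol\<omega> \<omega>0 no, of 0] by auto
    have "(\<lambda>z. \<alpha> * z) has_fps_expansion fps_const \<alpha> * fps_X"
      by (intro fps_expansion_intros)
    then have W: "\<omega> has_fps_expansion fps_const \<alpha> * fps_X"
      by (rule has_fps_expansion_transfer_disc) (simp add: \<alpha>)
    show ?thesis
      unfolding taylor_coeff_eqI[OF W] by (simp add: \<alpha>)
  qed
qed

section \<open>The coefficients of \<open>f\<close> in terms of the Schwarz function\<close>

text \<open>
  These are exact formulas, so they serve twice: for the upper bounds and for the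
  coefficients of the extremal functions. They come from \<open>z f' = f \<cdot> (1 + \<omega>)\<^sup>l\<close>, read as an
  identity of power series with the binomial series composed with that of \<open>\<omega>\<close>.
\<close>

lemma coeffs_of_Schwarz_function:
  assumes f: "f \<in> ST"
    and hol\<omega>: "\<omega> holomorphic_on unit_disc" and \<omega>0: "\<omega> 0 = 0"
    and eq: "\<And>z. z \<in> unit_disc \<Longrightarrow> zf'_over_f f z = (1 + \<omega> z) powr complex_of_real l"
  shows "taylor_coeff f 2 = of_real l * taylor_coeff \<omega> 1"
    and "taylor_coeff f 3 =
      of_real (l / 2) * (taylor_coeff \<omega> 2 + of_real ((3 * l - 1) / 2) * (taylor_coeff \<omega> 1)\<^sup>2)"
proof -
  define A where "A = fps_expansion f 0"
  define W where "W = fps_expansion \<omega> 0"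
  define B where "B = fps_binomial (complex_of_real l)"
  from f have holf: "f holomorphic_on unit_disc" and inj: "inj_on f unit_disc"
    and A0: "fps_nth A 0 = 0" and A1: "fps_nth A 1 = 1"
    by (auto simp: ST_def class_A_def taylor_coeff_def A_def)
  have f0: "f 0 = 0" using A0 by (simp add: A_def fps_expansion_def)
  have W0: "fps_nth W 0 = 0" using \<omega>0 by (simp add: W_def fps_expansion_def)
  have Af: "f has_fps_expansion A" and W\<omega>: "\<omega> has_fps_expansion W"
    unfolding A_def W_def by (intro has_fps_expansion_taylor holf hol\<omega>)+
  have prod: "z * deriv f z = f z * ((\<lambda>z. (1 + z) powr complex_of_real l) \<circ> \<omega>) z" if "z \<in> unit_disc" for z
  proof (cases "z = 0")
    case False
    with inj f0 that have "f z \<noteq> 0"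
      by (metis centre_in_ball inj_on_def zero_less_one)
    with eq[OF that] False show ?thesis by (simp add: zf'_over_f_def field_simps)
  qed (simp add: f0)
  have 1: "(\<lambda>z. z * deriv f z) has_fps_expansion fps_X * fps_deriv A"
    by (intro has_fps_expansion_mult has_fps_expansion_fps_X has_fps_expansion_deriv Af)
  have 2: "(\<lambda>z. f z * ((\<lambda>z. (1 + z) powr complex_of_real l) \<circ> \<omega>) z) has_fps_expansion A * (B oo W)"
    unfolding B_def
    by (intro has_fps_expansion_mult Af has_fps_expansion_compose
        has_fps_expansion_binomial_complex W\<omega> W0)
  have "(\<lambda>z. f z * ((\<lambda>z. (1 + z) powr complex_of_real l) \<circ> \<omega>) z) has_fps_expansion fps_X * fps_deriv A"
    by (rule has_fps_expansion_transfer_disc[OF 1 prod])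
  from fps_expansion_unique_complex[OF this 2]
  \<comment> \<open>Coefficient \<open>n\<close> on the left is \<open>n a\<^sub>n\<close>; subtracting the term \<open>a\<^sub>n\<close> on the right leaves
    \<open>(n - 1) a\<^sub>n\<close> in terms of earlier coefficients.\<close>
  have series: "fps_nth (fps_X * fps_deriv A) n = fps_nth (A * (B oo W)) n" for n
    by simp
  have B: "fps_nth B 0 = 1" "fps_nth B 1 = of_real l" "fps_nth B 2 = of_real l * (of_real l - 1) / 2"
    by (simp_all add: B_def gbinomial_Suc numeral_2_eq_2 fact_numeral gbinomial_prod_rev field_simps)
  have C0: "fps_nth (B oo W) 0 = 1"
    using B by (simp add: fps_compose_nth)
  have C1: "fps_nth (B oo W) 1 = of_real l * fps_nth W 1"
    using B W0 by (simp add: fps_compose_nth)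
  have C2: "fps_nth (B oo W) 2 = of_real l * fps_nth W 2 + of_real l * (of_real l - 1) / 2 * (fps_nth W 1)\<^sup>2"
  proof -
    have "fps_nth (B oo W) 2 = fps_nth B 1 * fps_nth W 2 + fps_nth B 2 * (fps_nth W 1)\<^sup>2"
      using W0 by (simp add: fps_compose_nth numeral_2_eq_2 fps_mult_nth)
    then show ?thesis unfolding B .
  qed
  have a2: "fps_nth A 2 = of_real l * fps_nth W 1"
    using series[of 2] A0 A1 C0 C1 C2 by (simp add: numeral_2_eq_2 fps_mult_nth)
  have a3: "2 * fps_nth A 3 = fps_nth A 2 * fps_nth (B oo W) 1 + fps_nth (B oo W) 2"
    using series[of 3] A0 A1 C0 by (simp add: numeral_2_eq_2 numeral_3_eq_3 fps_mult_nth algebra_simps)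
  show "taylor_coeff f 2 = of_real l * taylor_coeff \<omega> 1"
    using a2 by (simp add: taylor_coeff_def A_def W_def)
  have "fps_nth A 3 = of_real (l / 2) * (fps_nth W 2 + of_real ((3 * l - 1) / 2) * (fps_nth W 1)\<^sup>2)"
    using a3 unfolding a2 C1 C2 by (simp add: field_simps power2_eq_square)
  then show "taylor_coeff f 3 =
      of_real (l / 2) * (taylor_coeff \<omega> 2 + of_real ((3 * l - 1) / 2) * (taylor_coeff \<omega> 1)\<^sup>2)"
    by (simp add: taylor_coeff_def A_def W_def)
qed

section \<open>Univalence of starlike functions\<close>

text \<open>
  Along the segment from \<open>a\<close> to \<open>b\<close> the derivative of \<open>h / (b - a)\<close> is \<open>h'\<close>, so the real part
  of \<open>h / (b - a)\<close> strictly increases and \<open>h a \<noteq> h b\<close>.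
\<close>

lemma Noshiro_Warschawski:
  assumes "convex S"
    and deriv: "\<And>z. z \<in> S \<Longrightarrow> (h has_field_derivative h' z) (at z)"
    and pos: "\<And>z. z \<in> S \<Longrightarrow> Re (h' z) > 0"
  shows "inj_on h S"
proof (rule inj_onI, rule ccontr)
  fix a b assume ab: "a \<in> S" "b \<in> S" "h a = h b" "a \<noteq> b"
  define \<gamma> where "\<gamma> = (\<lambda>t. a + of_real t * (b - a))"
  have \<gamma>S: "\<gamma> t \<in> S" if "0 \<le> t" "t \<le> 1" for t
    using convexD_alt[OF \<open>convex S\<close> ab(1,2) that] by (simp add: \<gamma>_def scaleR_conv_of_real algebra_simps)
  have "\<exists>y. ((\<lambda>t. Re (h (\<gamma> t) / (b - a))) has_real_derivative y) (at t) \<and> y > 0"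
    if t: "0 \<le> t" "t \<le> 1" for t
  proof (intro exI conjI)
    have "(\<gamma> has_vector_derivative (b - a)) (at t)"
      unfolding \<gamma>_def by (auto intro!: derivative_eq_intros)
    then have "((h \<circ> \<gamma>) has_vector_derivative (b - a) * h' (\<gamma> t)) (at t)"
      by (rule field_vector_diff_chain_at) (rule deriv[OF \<gamma>S[OF t]])
    then have "((\<lambda>t. h (\<gamma> t) / (b - a)) has_vector_derivative (b - a) * h' (\<gamma> t) / (b - a)) (at t)"
      unfolding o_def by (rule has_vector_derivative_divide)
    then have "((\<lambda>t. h (\<gamma> t) / (b - a)) has_vector_derivative h' (\<gamma> t)) (at t)"
      using ab(4) by simp
    then show "((\<lambda>t. Re (h (\<gamma> t) / (b - a))) has_real_derivative Re (h' (\<gamma> t))) (at t)"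
      by (rule has_vector_derivative_complex_iff[THEN iffD1, THEN conjunct1])
    show "Re (h' (\<gamma> t)) > 0" by (rule pos[OF \<gamma>S[OF t]])
  qed
  then have "Re (h (\<gamma> 0) / (b - a)) < Re (h (\<gamma> 1) / (b - a))"
    by (rule DERIV_pos_imp_increasing[OF zero_less_one])
  with ab(3) show False by (simp add: \<gamma>_def)
qed

text \<open>
  For \<open>f z = z * exp (G z)\<close> the quantity \<open>1 + z G'(z)\<close> is \<open>z f'(z) / f(z)\<close>. On the left
  half-plane the lift \<open>h(w) = log f(e\<^sup>w) = w + G(e\<^sup>w)\<close> has exactly this quantity as
  its derivative, at \<open>z = e\<^sup>w\<close>. As the half-plane is convex, \<open>h\<close> is injective by
  Noshiro-Warschawski. If \<open>f x = f y\<close>, the lifted values at \<open>log x\<close> and \<open>log y\<close> differ by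
  \<open>2 \<pi> i k\<close>; since \<open>h (w + 2 \<pi> i k) = h w + 2 \<pi> i k\<close>, so do the logarithms.
\<close>

lemma starlike_imp_univalent:
  assumes hol: "G holomorphic_on unit_disc"
    and pos: "\<And>z. z \<in> unit_disc \<Longrightarrow> Re (1 + z * deriv G z) > 0"
  shows "inj_on (\<lambda>z. z * exp (G z)) unit_disc"
proof (rule inj_onI)
  fix x y assume xy: "x \<in> unit_disc" "y \<in> unit_disc" "x * exp (G x) = y * exp (G y)"
  show "x = y"
  proof (cases "x = 0 \<or> y = 0")
    case False
    define h where "h = (\<lambda>w. w + G (exp w))"
    have disc: "exp w \<in> unit_disc" if "Re w < 0" for w :: complex
      using that by simp
    have inj: "inj_on h {w. Re w < 0}"
    proof (rule Noshiro_Warschawski)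
      show "convex {w. Re w < 0}" by (rule convex_halfspace_Re_lt)
      fix w :: complex assume w: "w \<in> {w. Re w < 0}"
      then have "(G has_field_derivative deriv G (exp w)) (at (exp w))"
        by (intro holomorphic_derivI[OF hol] disc) auto
      then have "((\<lambda>w. G (exp w)) has_field_derivative deriv G (exp w) * exp w) (at w)"
        by (rule DERIV_chain2) (rule DERIV_exp)
      then show "(h has_field_derivative 1 + exp w * deriv G (exp w)) (at w)"
        unfolding h_def by (auto intro!: derivative_eq_intros)
      show "Re (1 + exp w * deriv G (exp w)) > 0"
        using pos[OF disc] w by blast
    qed
    have ReLn: "Re (Ln x) < 0" "Re (Ln y) < 0"
      using False xy by (auto simp: Re_Ln)
    have "exp (h (Ln x)) = exp (h (Ln y))"
      using False xy(3) by (simp add: h_def exp_add)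
    then obtain k :: int where k: "h (Ln x) = h (Ln y) + (of_int (2 * k) * pi) * \<i>"
      unfolding exp_eq by auto
    have "exp (Ln y + (of_int (2 * k) * pi) * \<i>) = exp (Ln y)"
      unfolding exp_eq by blast
    with k have eq: "h (Ln x) = h (Ln y + (of_int (2 * k) * pi) * \<i>)"
      unfolding h_def by (simp only: add_ac)
    have "Ln x = Ln y + (of_int (2 * k) * pi) * \<i>"
      by (rule inj_onD[OF inj eq]) (simp_all add: ReLn del: Re_Ln)
    then have "exp (Ln x) = exp (Ln y)"
      unfolding exp_eq by blast
    then show ?thesis using False by simp
  qed (use xy(3) in auto)
qed

section \<open>The extremal functions\<close>

lemma Re_one_plus_pos: "Re (1 + w) > 0" if "cmod w < 1"
  using abs_Re_le_cmod[of w] that by simp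

text \<open>An exponent between \<open>0\<close> and \<open>1\<close> does not enlarge the argument, which stays within
  \<open>\<pi> / 2\<close> of the positive axis.\<close>

lemma Re_powr_pos:
  assumes "Re w > 0" "0 \<le> l" "l \<le> 1"
  shows "Re (w powr complex_of_real l) > 0"
proof -
  have w: "w \<noteq> 0" using assms by auto
  have im: "\<bar>Im (Ln w)\<bar> < pi / 2"
    using assms Re_Ln_pos_lt[OF w] by simp
  have "\<bar>l * Im (Ln w)\<bar> \<le> \<bar>Im (Ln w)\<bar>"
    using assms by (simp add: abs_mult mult_left_le_one_le)
  with im have "cos (l * Im (Ln w)) > 0"
    by (intro cos_gt_zero_pi) (auto simp: abs_le_iff)
  with w show ?thesis
    by (simp add: powr_def Re_exp)
qed

text \<open>
  The exponent in the definition of \<open>F\<close> is replaced by a primitive \<open>G\<close> of the holomorphic extension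
  \<open>k\<close> of the integrand. The two integrands can differ only at \<open>0\<close>, one end of the segment
  of integration, which does not change the integral.
\<close>

lemma F_eq_id_times_exp:
  assumes "n \<ge> 1"
  obtains G where "G holomorphic_on unit_disc" "G 0 = 0"
    and "\<And>z. z \<in> unit_disc \<Longrightarrow> z * deriv G z = (1 + z ^ n) powr complex_of_real l - 1"
    and "\<And>z. z \<in> unit_disc \<Longrightarrow> F l n z = z * exp (G z)"
proof -
  define q where "q = (\<lambda>t::complex. (1 + t ^ n) powr complex_of_real l - 1)"
  \<comment> \<open>The limit of \<open>q t / t\<close> at \<open>0\<close> is \<open>deriv q 0\<close>, as \<open>q 0 = 0\<close>.\<close>
  define k where "k = (\<lambda>t. if t = 0 then deriv q 0 else q t / t)"
  have nonpos: "1 + t ^ n \<notin> \<real>\<^sub>\<le>\<^sub>0" if "cmod t < 1" for t :: complex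
  proof -
    have "cmod (t ^ n) < 1"
      using that assms by (simp add: norm_power power_less_one_iff)
    from Re_one_plus_pos[OF this] show ?thesis by (auto simp: complex_nonpos_Reals_iff)
  qed
  have q0: "q 0 = 0" using assms by (simp add: q_def power_0_left)
  have "q holomorphic_on unit_disc"
    unfolding q_def by (intro holomorphic_intros) (use nonpos in auto)
  then have "k holomorphic_on unit_disc"
    by (rule pole_theorem_open_0[where a = 0]) (auto simp: k_def q0)
  then obtain G0 where G0: "\<And>z. z \<in> unit_disc \<Longrightarrow> (G0 has_field_derivative k z) (at z within unit_disc)"
    using holomorphic_convex_primitive'[of unit_disc k] by auto
  define G where "G = (\<lambda>z. G0 z - G0 0)"
  have G: "(G has_field_derivative k z) (at z)" if "z \<in> unit_disc" for z
    unfolding G_def using G0[OF that] that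
    by (auto intro!: derivative_eq_intros simp: at_within_open[of z unit_disc])
  show ?thesis
  proof
    show "G holomorphic_on unit_disc"
      unfolding holomorphic_on_open[OF open_ball] using G by blast
    show "G 0 = 0" by (simp add: G_def)
    fix z assume z: "z \<in> unit_disc"
    have "deriv G z = k z" by (rule DERIV_imp_deriv[OF G[OF z]])
    then show "z * deriv G z = (1 + z ^ n) powr complex_of_real l - 1"
      using q0 by (auto simp: k_def q_def)
    show "F l n z = z * exp (G z)"
    proof (cases "z = 0")
      case False
      have "(k has_contour_integral (G (pathfinish (linepath 0 z)) - G (pathstart (linepath 0 z)))) (linepath 0 z)"
      proof (rule contour_integral_primitive[where S = unit_disc])
        show "path_image (linepath 0 z) \<subseteq> unit_disc"
          using z by (auto simp: closed_segment_subset)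
        show "(G has_field_derivative k x) (at x within unit_disc)" if "x \<in> unit_disc" for x
          using G[OF that] by (rule has_field_derivative_at_within)
      qed (rule valid_path_linepath)
      then have "((\<lambda>x. k (linepath 0 z x) * z) has_integral G z) {0..1}"
        by (simp add: has_contour_integral_linepath G_def)
      then have "((\<lambda>x. q (linepath 0 z x) / linepath 0 z x * z) has_integral G z) {0..1}"
        by (rule has_integral_spike_finite[of "{0}", rotated 2])
           (use False in \<open>auto simp: k_def linepath_def\<close>)
      then have "contour_integral (linepath 0 z) (\<lambda>t. q t / t) = G z"
        by (intro contour_integral_unique) (simp add: has_contour_integral_linepath)
      then show ?thesis by (simp add: F_def q_def)
    qed (simp add: F_def)
  qed
qed

text \<open>
  Because \<open>\<bar>\<mu>\<bar> = 1\<close>, the rotated function is \<open>z * exp (G (\<mu> * z))\<close>: the factors \<open>cnj \<mu>\<close> and \<open>\<mu>\<close>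
  cancel. Its logarithmic derivative therefore comes directly from that of \<open>G\<close>.
\<close>

lemma rotated_F_in_ST:
  assumes l: "0 < l" "l \<le> 1" and n: "n \<ge> 1" and \<mu>: "cmod \<mu> = 1"
  defines "f \<equiv> \<lambda>z. cnj \<mu> * F l n (\<mu> * z)"
  shows "f \<in> ST"
    and "\<And>z. z \<in> unit_disc \<Longrightarrow> zf'_over_f f z = (1 + (\<mu> * z) ^ n) powr complex_of_real l"
proof -
  obtain G where holG: "G holomorphic_on unit_disc" and G0: "G 0 = 0"
    and dG: "\<And>z. z \<in> unit_disc \<Longrightarrow> z * deriv G z = (1 + z ^ n) powr complex_of_real l - 1"
    and FG: "\<And>z. z \<in> unit_disc \<Longrightarrow> F l n z = z * exp (G z)"
    using F_eq_id_times_exp[OF n] by blast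
  define H where "H = (\<lambda>z. G (\<mu> * z))"
  have rot: "\<mu> * z \<in> unit_disc" if "z \<in> unit_disc" for z
    using that \<mu> by (simp add: norm_mult)
  have H: "(H has_field_derivative deriv G (\<mu> * z) * \<mu>) (at z)" if "z \<in> unit_disc" for z
    unfolding H_def
    by (rule DERIV_chain2[where g = "\<lambda>z. \<mu> * z"])
       (auto intro!: derivative_eq_intros holomorphic_derivI[OF holG] rot that)
  have holH: "H holomorphic_on unit_disc"
    unfolding holomorphic_on_open[OF open_ball] using H by blast
  have dH: "1 + z * deriv H z = (1 + (\<mu> * z) ^ n) powr complex_of_real l" if "z \<in> unit_disc" for z
    using dG[OF rot[OF that]] DERIV_imp_deriv[OF H[OF that]] by (simp add: algebra_simps)
  have "cnj \<mu> * \<mu> = 1"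
    using \<mu> complex_norm_square[of \<mu>] by (simp add: mult.commute)
  then have f: "f z = z * exp (H z)" if "z \<in> unit_disc" for z
    unfolding f_def H_def FG[OF rot[OF that]] by (simp add: mult.assoc[symmetric])
  have pos: "Re (1 + z * deriv H z) > 0" if "z \<in> unit_disc" for z
  proof -
    have "cmod ((\<mu> * z) ^ n) < 1"
      using rot[OF that] n by (simp add: norm_power power_less_one_iff)
    then show ?thesis
      unfolding dH[OF that] using l by (intro Re_powr_pos Re_one_plus_pos) auto
  qed
  have df: "(f has_field_derivative exp (H z) * (1 + z * deriv H z)) (at z)" if z: "z \<in> unit_disc" for z
  proof -
    have "(H has_field_derivative deriv H z) (at z)"
      by (rule holomorphic_derivI[OF holH _ z]) simp
    then have "((\<lambda>z. z * exp (H z)) has_field_derivative exp (H z) * (1 + z * deriv H z)) (at z)"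
      by (auto intro!: derivative_eq_intros simp: algebra_simps)
    then show ?thesis
      by (rule has_field_derivative_transform_within_open[of _ _ _ unit_disc]) (use z f in auto)
  qed
  have zf: "zf'_over_f f z = 1 + z * deriv H z" if "z \<in> unit_disc" for z
    using f[OF that] DERIV_imp_deriv[OF df[OF that]] by (simp add: zf'_over_f_def)
  then show "\<And>z. z \<in> unit_disc \<Longrightarrow> zf'_over_f f z = (1 + (\<mu> * z) ^ n) powr complex_of_real l"
    using dH by simp
  have "f holomorphic_on unit_disc"
    unfolding holomorphic_on_open[OF open_ball] using df by blast
  moreover have "taylor_coeff f 0 = 0"
    using f[of 0] by (simp add: taylor_coeff_def fps_expansion_def)
  moreover have "taylor_coeff f 1 = 1"
    using DERIV_imp_deriv[OF df[of 0]] by (simp add: taylor_coeff_def fps_expansion_def H_def G0)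
  moreover have "inj_on f unit_disc"
    using starlike_imp_univalent[OF holH pos] inj_on_cong[of unit_disc f "\<lambda>z. z * exp (H z)"] f
    by blast
  ultimately show "f \<in> ST"
    using zf pos by (simp add: ST_def class_A_def)
qed

lemma rotated_F_in_ST_ss:
  assumes l: "0 < l" "l \<le> 1" and n: "n \<ge> 1" and \<mu>: "cmod \<mu> = 1"
  shows "(\<lambda>z. cnj \<mu> * F l n (\<mu> * z)) \<in> ST_ss l"
proof -
  have "(\<lambda>z. (\<mu> * z) ^ n) ` unit_disc \<subseteq> unit_disc"
    using n \<mu> by (auto simp: norm_power norm_mult power_less_one_iff)
  moreover have "(\<lambda>z. (\<mu> * z) ^ n) holomorphic_on unit_disc"
    by (intro holomorphic_intros)
  ultimately show ?thesis
    using rotated_F_in_ST[OF assms] n unfolding ST_ss_def subordinate_def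
    by (auto intro!: exI[of _ "\<lambda>z. (\<mu> * z) ^ n"])
qed

section \<open>The sharp bounds\<close>

lemma taylor_coeff_rotated_power:
  "taylor_coeff (\<lambda>z. (\<mu> * z) ^ n) m = (if m = n then \<mu> ^ n else 0)"
proof -
  have "(\<lambda>z. \<mu> ^ n * z ^ n) has_fps_expansion fps_const (\<mu> ^ n) * fps_X ^ n"
    by (intro fps_expansion_intros)
  from taylor_coeff_eqI[OF this] show ?thesis
    by (simp add: power_mult_distrib fps_X_power_nth)
qed

text \<open>
  With \<open>\<bar>(3 l - 1) / 2\<bar> \<le> 1\<close> the second factor of \<open>a\<^sub>3\<close> is at most
  \<open>\<bar>c\<^sub>2\<bar> + \<bar>c\<^sub>1\<bar>\<^sup>2 \<le> 1\<close>.
\<close>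

lemma ST_ss_coeff_bounds:
  assumes l: "0 < l" "l \<le> 1" and "f \<in> ST_ss l"
  shows "cmod (taylor_coeff f 2) \<le> l" "cmod (taylor_coeff f 3) \<le> l / 2"
proof -
  from assms obtain \<omega> where f: "f \<in> ST" and \<omega>: "\<omega> holomorphic_on unit_disc"
    "\<omega> ` unit_disc \<subseteq> unit_disc" "\<omega> 0 = 0"
    and eq: "\<And>z. z \<in> unit_disc \<Longrightarrow> zf'_over_f f z = (1 + \<omega> z) powr complex_of_real l"
    unfolding ST_ss_def subordinate_def by blast
  define c where "c = taylor_coeff \<omega> 1"
  define d where "d = taylor_coeff \<omega> 2"
  have cd: "cmod d \<le> 1 - (cmod c)\<^sup>2"
    unfolding c_def d_def by (rule Schwarz_function_second_coeff[OF \<omega>])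
  then have "(cmod c)\<^sup>2 \<le> 1" using norm_ge_zero[of d] by linarith
  then have c1: "cmod c \<le> 1" by (simp add: abs_square_le_1)
  have a2: "taylor_coeff f 2 = of_real l * c"
    and a3: "taylor_coeff f 3 = of_real (l / 2) * (d + of_real ((3 * l - 1) / 2) * c\<^sup>2)"
    unfolding c_def d_def by (rule coeffs_of_Schwarz_function[OF f \<omega>(1,3) eq]; assumption)+
  show "cmod (taylor_coeff f 2) \<le> l"
    unfolding a2 using l c1 by (simp add: norm_mult mult_left_le)
  have abs1: "\<bar>(3 * l - 1) / 2\<bar> \<le> 1" using l by (auto simp: abs_le_iff)
  have "cmod (d + of_real ((3 * l - 1) / 2) * c\<^sup>2) \<le> cmod d + \<bar>(3 * l - 1) / 2\<bar> * (cmod c)\<^sup>2"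
    by (rule order_trans[OF norm_triangle_ineq])
       (simp only: norm_mult norm_power norm_of_real order_refl)
  also have "\<dots> \<le> cmod d + 1 * (cmod c)\<^sup>2"
    using abs1 by (intro add_left_mono mult_right_mono) auto
  also have "\<dots> \<le> 1" using cd by simp
  finally have "l / 2 * cmod (d + of_real ((3 * l - 1) / 2) * c\<^sup>2) \<le> l / 2 * 1"
    using l by (intro mult_left_mono) auto
  then show "cmod (taylor_coeff f 3) \<le> l / 2"
    unfolding a3 norm_mult norm_of_real using l by simp
qed

theorem corollary5p5:
  fixes l :: real
  assumes "0 < l" and "l \<le> 1"
  shows "(\<forall>f \<in> ST_ss l. cmod (taylor_coeff f 2) \<le> l \<and> cmod (taylor_coeff f 3) \<le> l / 2) \<and>
         (\<forall>\<mu>::complex. cmod \<mu> = 1 \<longrightarrow>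
           (\<lambda>z. cnj \<mu> * F l 1 (\<mu> * z)) \<in> ST_ss l \<and>
           cmod (taylor_coeff (\<lambda>z. cnj \<mu> * F l 1 (\<mu> * z)) 2) = l) \<and>
         (\<forall>\<mu>::complex. cmod \<mu> = 1 \<longrightarrow>
           (\<lambda>z. cnj \<mu> * F l 2 (\<mu> * z)) \<in> ST_ss l \<and>
           cmod (taylor_coeff (\<lambda>z. cnj \<mu> * F l 2 (\<mu> * z)) 3) = l / 2)"
proof -
  have coeffs:
    "taylor_coeff (\<lambda>z. cnj \<mu> * F l n (\<mu> * z)) 2 = of_real l * taylor_coeff (\<lambda>z. (\<mu> * z) ^ n) 1"
    "taylor_coeff (\<lambda>z. cnj \<mu> * F l n (\<mu> * z)) 3 =
       of_real (l / 2) * (taylor_coeff (\<lambda>z. (\<mu> * z) ^ n) 2 +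
         of_real ((3 * l - 1) / 2) * (taylor_coeff (\<lambda>z. (\<mu> * z) ^ n) 1)\<^sup>2)"
    if "n \<ge> 1" "cmod \<mu> = 1" for n \<mu>
    using that
    by (intro coeffs_of_Schwarz_function rotated_F_in_ST assms holomorphic_intros; simp)+
  have "cmod (taylor_coeff (\<lambda>z. cnj \<mu> * F l 1 (\<mu> * z)) 2) = l"
    and "cmod (taylor_coeff (\<lambda>z. cnj \<mu> * F l 2 (\<mu> * z)) 3) = l / 2"
    if \<mu>: "cmod \<mu> = 1" for \<mu>
    unfolding coeffs(1)[OF order_refl \<mu>] coeffs(2)[OF one_le_numeral \<mu>] taylor_coeff_rotated_power
    using assms \<mu> by (simp_all add: norm_mult norm_power)
  then show ?thesis
    using ST_ss_coeff_bounds[OF assms] rotated_F_in_ST_ss[OF assms] by simp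
qed

end
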